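(* Let $G$ be a finite group containing a normal subgroup $H$ of prime index $p$. Every conjugacy class of $G$ contained in $H$, other than the class of the identity, is split if and only if $G$ is a Frobenius group with kernel $H$ and complement $C_p$.
   Context: $C_p$ denotes the cyclic group of order $p$. For $g \in G$ and a subgroup $K \le G$, write $g^K = \{k^{-1} g k : k \in K\}$. A conjugacy class $g^G$ of $G$ is called non-split (with respect to $H$) if $g^G = g^H$, and split otherwise. A finite group $G$ is a Frobenius group with complement $K$ if $K$ is a non-trivial proper subgroup of $G$ with $K \cap g^{-1}Kg = 1$ for all $g \in G \setminus K$; its kernel is then the set consisting of the identity together with all elements of $G$ lying in no conjugate of $K$.
   Formalization: The formal theorem also assumes that H is non-trivial; if H = 1 then G = C_p, every class condition holds vacuously, but G has no non-trivial proper subgroup and so is not a Frobenius group, making the equivalence false. *)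

theory Defs
  imports "HOL-Algebra.Elementary_Groups" "HOL-Computational_Algebra.Primes"
begin

definition conj_orbit :: "('a, 'b) monoid_scheme \<Rightarrow> 'a \<Rightarrow> 'a set \<Rightarrow> 'a set"
  where "conj_orbit G g K = {inv\<^bsub>G\<^esub> k \<otimes>\<^bsub>G\<^esub> g \<otimes>\<^bsub>G\<^esub> k | k. k \<in> K}"

definition conj_class :: "('a, 'b) monoid_scheme \<Rightarrow> 'a \<Rightarrow> 'a set"
  where "conj_class G g = conj_orbit G g (carrier G)"

(* A property of the class of g: for normal H, whether the equation holds does not
   depend on the representative g. *)
definition nonsplit_class :: "('a, 'b) monoid_scheme \<Rightarrow> 'a set \<Rightarrow> 'a \<Rightarrow> bool"
  where "nonsplit_class G H g \<longleftrightarrow> conj_class G g = conj_orbit G g H"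

abbreviation split_class :: "('a, 'b) monoid_scheme \<Rightarrow> 'a set \<Rightarrow> 'a \<Rightarrow> bool"
  where "split_class G H g \<equiv> \<not> nonsplit_class G H g"

definition frobenius_complement :: "('a, 'b) monoid_scheme \<Rightarrow> 'a set \<Rightarrow> bool"
  where "frobenius_complement G K \<longleftrightarrow>
    group G \<and> finite (carrier G) \<and> subgroup K G \<and> K \<noteq> {\<one>\<^bsub>G\<^esub>} \<and> K \<noteq> carrier G \<and>
    (\<forall>g \<in> carrier G - K. K \<inter> (inv\<^bsub>G\<^esub> g <#\<^bsub>G\<^esub> K #>\<^bsub>G\<^esub> g) = {\<one>\<^bsub>G\<^esub>})"

definition frobenius_kernel :: "('a, 'b) monoid_scheme \<Rightarrow> 'a set \<Rightarrow> 'a set"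
  where "frobenius_kernel G K =
    {\<one>\<^bsub>G\<^esub>} \<union> (carrier G - (\<Union>g \<in> carrier G. inv\<^bsub>G\<^esub> g <#\<^bsub>G\<^esub> K #>\<^bsub>G\<^esub> g))"

end

theory Submission
  imports Defs "HOL-Algebra.Multiplicative_Group"
begin

text \<open>
  The bridge between the two sides is a statement about centralisers. For \<open>g \<in> H\<close>, the class
  of \<open>g\<close> under \<open>G\<close> equals its class under \<open>H\<close> exactly when \<open>G = H C(g)\<close>, and since \<open>H\<close> has
  prime index this happens exactly when \<open>C(g)\<close> is not contained in \<open>H\<close>
  (\<open>split_class_iff_centralizer_subset\<close>). The theorem thus says that \<open>C(g) \<subseteq> H\<close> holds for
  all \<open>g \<in> H - {1}\<close> if and only if \<open>H\<close> is a Frobenius kernel with complement of order \<open>p\<close>.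

  A Frobenius kernel always contains the centralisers of its non-trivial elements: if \<open>x\<close> commutes
  with \<open>g\<close> and lies in a conjugate \<open>L\<close> of the complement, then a non-trivial \<open>x\<close> lies in both
  \<open>L\<close> and \<open>L\<close> conjugated by \<open>g\<close>, which forces \<open>g \<in> L\<close>
  (\<open>centralizer_subset_frobenius_kernel\<close>).

  Conversely, let all these centralisers lie in \<open>H\<close>, and choose any \<open>x \<notin> H\<close>. The element
  \<open>x\<^sup>p\<close> lies in \<open>H\<close> and commutes with \<open>x\<close>, so it is trivial: \<open>x\<close> has order \<open>p\<close>, and
  \<open>K = \<langle>x\<rangle>\<close> meets \<open>H\<close> trivially. An element \<open>g\<close> for which \<open>K\<close> meets its
  conjugate by \<open>g\<close> non-trivially must lie in \<open>K\<close>, since modulo \<open>K\<close> it is represented by an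
  element of \<open>H\<close> that commutes with a non-trivial element of \<open>K\<close>.
  Each \<open>y \<in> K - {1}\<close> acts on \<open>H\<close> without non-trivial fixed points, so by counting the
  conjugates of \<open>y\<close> under \<open>H\<close> fill the whole coset \<open>H y\<close> (\<open>rcoset_eq_conj_orbit\<close>). Hence
  the conjugates of \<open>K\<close> cover everything outside \<open>H\<close>, while they meet \<open>H\<close> trivially because
  \<open>K\<close> does.
\<close>

section \<open>Conjugation\<close>

lemma (in group) conjugate_eq_iff:
  assumes "k \<in> carrier G" "g \<in> carrier G" "y \<in> carrier G"
  shows "inv k \<otimes> g \<otimes> k = y \<longleftrightarrow> g \<otimes> k = k \<otimes> y"
  using assms by (metis inv_closed m_assoc m_closed inv_solve_left)

lemma (in group) mult_inv_cancel_left: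
  assumes "x \<in> carrier G" "y \<in> carrier G"
  shows "x \<otimes> (inv x \<otimes> y) = y" "inv x \<otimes> (x \<otimes> y) = y"
  using assms by (simp_all add: m_assoc[symmetric])

lemma (in group) conjugate_inv_eq_iff:
  assumes "k \<in> carrier G" "g \<in> carrier G" "y \<in> carrier G"
  shows "k \<otimes> g \<otimes> inv k = y \<longleftrightarrow> k \<otimes> g = y \<otimes> k"
  using assms by (simp add: inv_solve_right')

lemma mem_conj_orbit_iff: "y \<in> conj_orbit G g K \<longleftrightarrow> (\<exists>k\<in>K. y = inv\<^bsub>G\<^esub> k \<otimes>\<^bsub>G\<^esub> g \<otimes>\<^bsub>G\<^esub> k)"
  unfolding conj_orbit_def by blast

lemma (in group) mem_conjugate_iff:
  assumes "K \<subseteq> carrier G" "g \<in> carrier G" "x \<in> carrier G"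
  shows "x \<in> inv g <# K #> g \<longleftrightarrow> g \<otimes> x \<otimes> inv g \<in> K"
proof
  assume "x \<in> inv g <# K #> g"
  then obtain k where k: "k \<in> K" "x = inv g \<otimes> k \<otimes> g"
    unfolding l_coset_def r_coset_def by blast
  then have "k \<in> carrier G" using assms by blast
  then have "g \<otimes> x \<otimes> inv g = k"
    using k(2) assms by (simp add: m_assoc mult_inv_cancel_left)
  then show "g \<otimes> x \<otimes> inv g \<in> K" using k(1) by simp
next
  assume a: "g \<otimes> x \<otimes> inv g \<in> K"
  have "x = inv g \<otimes> (g \<otimes> x \<otimes> inv g) \<otimes> g"
    using assms by (simp add: m_assoc mult_inv_cancel_left)
  with a show "x \<in> inv g <# K #> g"
    unfolding l_coset_def r_coset_def by blast
qed

section \<open>Finite cyclic subgroups\<close>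

text \<open>The isomorphism is inverse to \<open>i \<mapsto> x\<^sup>i\<close>, which depends only on \<open>i\<close> modulo the
  order of \<open>x\<close>.\<close>
lemma (in group) generate_singleton_iso_integer_mod_group:
  assumes x: "x \<in> carrier G" and pos: "ord x > 0"
  shows "G\<lparr>carrier := generate G {x}\<rparr> \<cong> integer_mod_group (ord x)"
proof -
  let ?Z = "integer_mod_group (ord x)" and ?K = "G\<lparr>carrier := generate G {x}\<rparr>"
  let ?f = "\<lambda>i::int. x [^] i"
  have carr: "carrier ?Z = {0..<int (ord x)}"
    using pos by (simp add: carrier_integer_mod_group)
  have eq: "x [^] i = x [^] j \<longleftrightarrow> int (ord x) dvd i - j" for i j :: int
    using int_pow_eq[OF x, of i j] by (simp add: dvd_diff_commute)
  have gen: "generate G {x} = range ?f"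
    using generate_pow[OF x] by auto
  have "?f \<in> iso ?Z ?K"
  proof (rule isoI)
    show "?f \<in> hom ?Z ?K"
    proof (rule homI)
      fix i j :: int
      have "x [^] ((i + j) mod int (ord x)) = x [^] (i + j)"
        unfolding eq by (metis dvd_diff_commute dvd_minus_mod)
      then show "x [^] (i \<otimes>\<^bsub>?Z\<^esub> j) = x [^] i \<otimes>\<^bsub>?K\<^esub> x [^] j"
        using x by (simp add: int_pow_mult)
    qed (auto simp: gen)
    have "inj_on ?f {0..<int (ord x)}"
      unfolding inj_on_def eq by (auto simp: mod_eq_dvd_iff[symmetric])
    moreover have "y \<in> ?f ` {0..<int (ord x)}" if "y \<in> range ?f" for y
    proof -
      from that obtain i :: int where "y = x [^] i" by blast
      also have "\<dots> = x [^] (i mod int (ord x))"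
        unfolding eq by (metis dvd_minus_mod)
      finally show ?thesis using pos by auto
    qed
    ultimately show "bij_betw ?f (carrier ?Z) (carrier ?K)"
      unfolding bij_betw_def carr using gen by auto
  qed
  then show ?thesis
    using group.iso_sym[OF group_integer_mod_group] unfolding is_iso_def by blast
qed

section \<open>Centralisers in a Frobenius kernel\<close>

text \<open>An element \<open>x\<close> outside the kernel lies in a conjugate of \<open>K\<close>. Moving that conjugate
  back to \<open>K\<close> turns \<open>x\<close> and \<open>g\<close> into commuting elements \<open>y \<in> K\<close> and \<open>b\<close>, and then
  \<open>y\<close> lies in \<open>K\<close> and in its conjugate by \<open>b\<close>; this is impossible unless \<open>b \<in> K\<close>, that is,
  unless \<open>g\<close> too is outside the kernel.\<close>
lemma (in group) centralizer_subset_frobenius_kernel: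
  assumes K: "frobenius_complement G K"
    and g: "g \<in> frobenius_kernel G K" "g \<noteq> \<one>"
    and x: "x \<in> carrier G" "x \<otimes> g = g \<otimes> x"
  shows "x \<in> frobenius_kernel G K"
proof (rule ccontr)
  assume nx: "x \<notin> frobenius_kernel G K"
  have Kc: "K \<subseteq> carrier G" and ti: "\<And>b. b \<in> carrier G - K \<Longrightarrow> K \<inter> (inv b <# K #> b) = {\<one>}"
    using K unfolding frobenius_complement_def by (auto dest: subgroup.subset)
  have gc: "g \<in> carrier G" using g unfolding frobenius_kernel_def by auto
  obtain a where a: "a \<in> carrier G" "x \<in> inv a <# K #> a" and "x \<noteq> \<one>"
    using nx x unfolding frobenius_kernel_def by auto
  let ?y = "a \<otimes> x \<otimes> inv a" and ?b = "a \<otimes> g \<otimes> inv a"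
  have yK: "?y \<in> K" using a mem_conjugate_iff[OF Kc a(1) x(1)] by simp
  have yc: "?y \<in> carrier G" and bc: "?b \<in> carrier G" using a x gc by auto
  have "?y \<noteq> \<one>"
    using \<open>x \<noteq> \<one>\<close> a(1) x(1) by (simp add: conjugate_inv_eq_iff)
  have "?b \<otimes> ?y = a \<otimes> (g \<otimes> x) \<otimes> inv a"
    using a(1) gc x(1) by (simp add: m_assoc mult_inv_cancel_left)
  also have "\<dots> = ?y \<otimes> ?b"
    unfolding x(2)[symmetric] using a(1) gc x(1) by (simp add: m_assoc mult_inv_cancel_left)
  finally have "?b \<otimes> ?y \<otimes> inv ?b = ?y"
    by (subst conjugate_inv_eq_iff[OF bc yc yc])
  then have "?y \<in> inv ?b <# K #> ?b"
    using mem_conjugate_iff[OF Kc bc yc] yK by simp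
  then have "?b \<in> K" using ti bc yK \<open>?y \<noteq> \<one>\<close> by blast
  then have "g \<in> inv a <# K #> a" using mem_conjugate_iff[OF Kc a(1) gc] by simp
  then show False using g a(1) unfolding frobenius_kernel_def by auto
qed

section \<open>Cosets of a normal subgroup as conjugacy orbits\<close>

lemma (in normal) mem_iff_rcoset_eq: "x \<in> carrier G \<Longrightarrow> x \<in> H \<longleftrightarrow> H #> x = H"
  by (metis coset_join1 coset_join2 is_subgroup subset)

text \<open>Normality keeps the conjugates of \<open>x\<close> under \<open>H\<close> in the coset of \<open>x\<close>. There are
  \<open>|H|\<close> distinct ones, because two elements of \<open>H\<close> conjugating \<open>x\<close> to the same element differ
  by an element that commutes with \<open>x\<close>; so they exhaust the coset.\<close>
lemma (in normal) rcoset_eq_conj_orbit: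
  assumes finH: "finite H" and x: "x \<in> carrier G"
    and fpf: "\<And>h. h \<in> H \<Longrightarrow> h \<otimes> x = x \<otimes> h \<Longrightarrow> h = \<one>"
  shows "H #> x = conj_orbit G x H"
proof -
  let ?f = "\<lambda>h. inv h \<otimes> x \<otimes> h"
  have sub: "?f ` H \<subseteq> H #> x"
  proof clarify
    fix h assume h: "h \<in> H"
    then have hc: "h \<in> carrier G" using subset by blast
    have "x \<otimes> h \<otimes> inv x \<in> H" using h x inv_op_closed2 by blast
    then have "inv h \<otimes> (x \<otimes> h \<otimes> inv x) \<in> H" using h by simp
    moreover have "?f h = inv h \<otimes> (x \<otimes> h \<otimes> inv x) \<otimes> x"
      using hc x by (simp add: m_assoc mult_inv_cancel_left)
    ultimately show "?f h \<in> H #> x" unfolding r_coset_def by blast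
  qed
  have "inj_on ?f H"
  proof (rule inj_onI)
    fix h k assume h: "h \<in> H" and k: "k \<in> H" and eq: "?f h = ?f k"
    then have c: "h \<in> carrier G" "k \<in> carrier G" using subset by auto
    have "x \<otimes> h = h \<otimes> (inv k \<otimes> x \<otimes> k)"
      using conjugate_eq_iff c x eq by simp
    then have "x \<otimes> h \<otimes> inv k = h \<otimes> (inv k \<otimes> x \<otimes> k) \<otimes> inv k" by simp
    then have "h \<otimes> inv k \<otimes> x = x \<otimes> (h \<otimes> inv k)" using c x by (simp add: m_assoc mult_inv_cancel_left)
    then have "h \<otimes> inv k = \<one>" using fpf h k by simp
    then show "h = k" using c by (simp add: inv_solve_right')
  qed
  then have "card (?f ` H) = card (H #> x)"
    using card_rcosets_equal[OF rcosetsI[OF subset x] subset] by (simp add: card_image)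
  moreover have "finite (H #> x)" using finH unfolding r_coset_def by simp
  ultimately have "?f ` H = H #> x" using sub card_subset_eq by blast
  then show ?thesis unfolding conj_orbit_def by blast
qed

section \<open>Normal subgroups of prime index\<close>

locale normal_prime_index = normal H G for H and G (structure) +
  fixes p :: nat
  assumes finite_carrier: "finite (carrier G)"
    and prime_p: "Factorial_Ring.prime p"
    and card_rcosets: "card (rcosets H) = p"
begin

lemma proper: "H \<noteq> carrier G"
proof
  assume "H = carrier G"
  then have "rcosets H = {H}"
    unfolding RCOSETS_def using coset_join2[OF _ is_subgroup] one_closed by auto
  then show False using card_rcosets prime_p by auto
qed

lemma finite_H: "finite H"
  using finite_carrier finite_subset subset by blast

lemma order_quotient: "order (G Mod H) = p"
  using card_rcosets by (simp add: order_def FactGroup_def)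

lemma pow_prime_mem:
  assumes x: "x \<in> carrier G"
  shows "x [^] p \<in> H"
proof -
  interpret Q: group "G Mod H" by (rule factorgroup_is_group)
  have "(H #> x) [^]\<^bsub>G Mod H\<^esub> p = \<one>\<^bsub>G Mod H\<^esub>"
    using Q.pow_order_eq_1[of "H #> x"] x by (simp add: order_quotient carrier_FactGroup)
  then show ?thesis
    using x by (simp add: FactGroup_pow mem_iff_rcoset_eq)
qed

text \<open>The quotient has prime order, so the image of any \<open>x \<notin> H\<close> generates it.\<close>
lemma mem_rcoset_pow:
  assumes x: "x \<in> carrier G" "x \<notin> H" and g: "g \<in> carrier G"
  shows "\<exists>i::nat. g \<in> H #> x [^] i"
proof -
  interpret Q: group "G Mod H" by (rule factorgroup_is_group)
  let ?X = "H #> x"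
  have X: "?X \<in> carrier (G Mod H)" using x by (simp add: carrier_FactGroup)
  have fin: "finite (carrier (G Mod H))" using finite_carrier by (simp add: carrier_FactGroup)
  have "Q.ord ?X dvd p" using Q.ord_dvd_group_order[OF X] by (simp add: order_quotient)
  moreover have "Q.ord ?X \<noteq> 1"
    using Q.ord_eq_1[OF X] x mem_iff_rcoset_eq by simp
  ultimately have "Q.ord ?X = p" using prime_p by (metis prime_nat_iff)
  then have "card (generate (G Mod H) {?X}) = card (carrier (G Mod H))"
    using Q.generate_pow_card[OF X] order_quotient by (simp add: order_def)
  then have "generate (G Mod H) {?X} = carrier (G Mod H)"
    using X fin Q.generate_incl[of "{?X}"] by (intro card_subset_eq) auto
  then have "H #> g \<in> generate (G Mod H) {?X}"
    using g by (simp add: carrier_FactGroup)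
  then obtain i :: nat where "H #> g = ?X [^]\<^bsub>G Mod H\<^esub> i"
    using Q.generate_pow_on_finite_carrier[OF fin X] by auto
  then have "H #> g = H #> x [^] i" using x by (simp add: FactGroup_pow)
  then show ?thesis using rcos_self[OF g is_subgroup] by auto
qed

text \<open>If \<open>g\<^sup>G = g\<^sup>H\<close>, an element \<open>x \<notin> H\<close> conjugates \<open>g\<close> in the same way as some
  \<open>h \<in> H\<close>, and then the product of \<open>x\<close> with the inverse of \<open>h\<close> centralises \<open>g\<close> outside
  \<open>H\<close>. Conversely, the powers of an \<open>x \<notin> H\<close> that centralises \<open>g\<close> represent all cosets of
  \<open>H\<close>, so conjugating by an element of \<open>G\<close> has the same effect on \<open>g\<close> as conjugating by its
  part in \<open>H\<close>.\<close>
lemma split_class_iff_centralizer_subset: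
  assumes g: "g \<in> H"
  shows "split_class G H g \<longleftrightarrow> (\<forall>x \<in> carrier G. x \<otimes> g = g \<otimes> x \<longrightarrow> x \<in> H)"
proof -
  have gc: "g \<in> carrier G" using g subset by blast
  have "nonsplit_class G H g \<longleftrightarrow> (\<exists>x \<in> carrier G - H. x \<otimes> g = g \<otimes> x)"
  proof
    assume ns: "nonsplit_class G H g"
    obtain x where x: "x \<in> carrier G" "x \<notin> H" using proper subset by blast
    have "inv x \<otimes> g \<otimes> x \<in> conj_class G g"
      using x unfolding conj_class_def mem_conj_orbit_iff by blast
    then obtain h where h: "h \<in> H" "inv x \<otimes> g \<otimes> x = inv h \<otimes> g \<otimes> h"
      using ns unfolding nonsplit_class_def by (auto simp: mem_conj_orbit_iff)
    have hc: "h \<in> carrier G" using h subset by blast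
    have "x \<otimes> inv h \<otimes> g = g \<otimes> (x \<otimes> inv h)"
    proof -
      have "g \<otimes> x = x \<otimes> (inv h \<otimes> g \<otimes> h)"
        using conjugate_eq_iff x(1) gc hc h(2) by simp
      then have "g \<otimes> x \<otimes> inv h = x \<otimes> (inv h \<otimes> g \<otimes> h) \<otimes> inv h" by simp
      then show ?thesis using x gc hc by (simp add: m_assoc mult_inv_cancel_left)
    qed
    moreover have "x \<otimes> inv h \<notin> H"
    proof
      assume "x \<otimes> inv h \<in> H"
      then have "x \<otimes> inv h \<otimes> h \<in> H" using h(1) by simp
      then show False using x hc by (simp add: m_assoc mult_inv_cancel_left)
    qed
    ultimately show "\<exists>x \<in> carrier G - H. x \<otimes> g = g \<otimes> x" using x hc by blast
  next
    assume "\<exists>x \<in> carrier G - H. x \<otimes> g = g \<otimes> x"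
    then obtain x where x: "x \<in> carrier G" "x \<notin> H" and comm: "x \<otimes> g = g \<otimes> x" by blast
    have "\<exists>h\<in>H. inv a \<otimes> g \<otimes> a = inv h \<otimes> g \<otimes> h" if a: "a \<in> carrier G" for a
    proof -
      \<comment> \<open>A factorisation of \<open>inv a\<close>, rather than of \<open>a\<close>, puts the
        power of \<open>x\<close> next to \<open>g\<close>.\<close>
      obtain i :: nat where "inv a \<in> H #> x [^] i" using mem_rcoset_pow[OF x] a by blast
      then obtain h where h: "h \<in> H" and ia: "inv a = h \<otimes> x [^] i"
        unfolding r_coset_def by blast
      have hc: "h \<in> carrier G" using h subset by blast
      let ?c = "x [^] i"
      have c: "?c \<in> carrier G" "?c \<otimes> g = g \<otimes> ?c"
        using x gc comm group_commutes_pow by auto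
      have "a = inv ?c \<otimes> inv h"
        using ia a c hc by (metis inv_inv inv_mult_group)
      then have "inv a \<otimes> g \<otimes> a = h \<otimes> (?c \<otimes> g) \<otimes> (inv ?c \<otimes> inv h)"
        using ia hc c(1) gc by (simp add: m_assoc mult_inv_cancel_left)
      also have "\<dots> = h \<otimes> g \<otimes> inv h"
        unfolding c(2) using hc c(1) gc by (simp add: m_assoc mult_inv_cancel_left)
      finally show ?thesis using h hc by (intro bexI[of _ "inv h"]) auto
    qed
    then show "nonsplit_class G H g"
      unfolding nonsplit_class_def conj_class_def
      using subset by (auto simp: mem_conj_orbit_iff set_eq_iff)
  qed
  then show ?thesis by blast
qed

lemma nontrivial_classes_split_iff:
  "(\<forall>g \<in> carrier G. conj_class G g \<subseteq> H \<and> conj_class G g \<noteq> conj_class G \<one> \<longrightarrow> split_class G H g)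
    \<longleftrightarrow> (\<forall>g \<in> H - {\<one>}. \<forall>x \<in> carrier G. x \<otimes> g = g \<otimes> x \<longrightarrow> x \<in> H)"
proof -
  have class_one: "conj_class G \<one> = {\<one>}"
    unfolding conj_class_def conj_orbit_def by (auto simp: conjugate_eq_iff intro!: exI[of _ \<one>])
  have self: "g \<in> conj_class G g" if "g \<in> carrier G" for g
    unfolding conj_class_def mem_conj_orbit_iff using that by (intro bexI[of _ \<one>]) auto
  have closed: "conj_class G g \<subseteq> H" if "g \<in> H" for g
    using that inv_op_closed1 by (auto simp: conj_class_def conj_orbit_def)
  have trivial: "conj_class G g = conj_class G \<one> \<longleftrightarrow> g = \<one>" if "g \<in> carrier G" for g
    using self[OF that] class_one by auto
  have nontrivial_in_H: "conj_class G g \<subseteq> H \<and> conj_class G g \<noteq> conj_class G \<one> \<longleftrightarrow> g \<in> H \<and> g \<noteq> \<one>"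
    if "g \<in> carrier G" for g
    using self[OF that] closed[of g] trivial[OF that] by blast
  have "(\<forall>g \<in> carrier G. conj_class G g \<subseteq> H \<and> conj_class G g \<noteq> conj_class G \<one> \<longrightarrow> split_class G H g)
      \<longleftrightarrow> (\<forall>g \<in> H - {\<one>}. split_class G H g)"
    using subset by (auto simp: nontrivial_in_H)
  also have "\<dots> \<longleftrightarrow> (\<forall>g \<in> H - {\<one>}. \<forall>x \<in> carrier G. x \<otimes> g = g \<otimes> x \<longrightarrow> x \<in> H)"
    using split_class_iff_centralizer_subset by blast
  finally show ?thesis .
qed

section \<open>The Frobenius structure\<close>

text \<open>A cyclic complement arises from any element outside \<open>H\<close>. The subgroup \<open>H\<close> must be
  non-trivial since otherwise \<open>\<langle>x\<rangle>\<close> is the whole group, which is not a proper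
  subgroup.\<close>
lemma frobenius_if_centralizers_subset:
  assumes nontriv: "H \<noteq> {\<one>}"
    and cent: "\<And>g x. g \<in> H \<Longrightarrow> g \<noteq> \<one> \<Longrightarrow> x \<in> carrier G \<Longrightarrow> x \<otimes> g = g \<otimes> x \<Longrightarrow> x \<in> H"
    and x: "x \<in> carrier G" "x \<notin> H"
  shows "frobenius_complement G (generate G {x})"
    and "frobenius_kernel G (generate G {x}) = H"
    and "G\<lparr>carrier := generate G {x}\<rparr> \<cong> integer_mod_group p"
proof -
  let ?K = "generate G {x}"
  have K: "?K = {x [^] k | k. k \<in> (UNIV :: nat set)}"
    by (rule generate_pow_on_finite_carrier[OF finite_carrier x(1)])
  have subK: "subgroup ?K G" using x by (intro generate_is_subgroup) simp
  then have Kc: "?K \<subseteq> carrier G" by (rule subgroup.subset)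
  have xK: "x \<in> ?K" by (simp add: generate.incl)
  have oneK: "\<one> \<in> ?K" using subK by (rule subgroup.one_closed)
  have K_comm: "y \<otimes> z = z \<otimes> y" if "y \<in> ?K" "z \<in> ?K" for y z
    using that x by (auto simp: K nat_pow_mult add.commute)
  \<comment> \<open>A non-trivial \<open>y\<close> in both would put its centraliser, and with it \<open>x\<close>, into \<open>H\<close>.\<close>
  have KH: "y = \<one>" if "y \<in> ?K" "y \<in> H" for y
    using cent[of y x] that K_comm xK x by blast
  have powp: "x [^] p = \<one>"
    using pow_prime_mem[OF x(1)] K by (intro KH) auto
  have "x \<noteq> \<one>" using x by auto
  then have ordx: "ord x = p"
    using powp x(1) prime_p by (metis ord_eq_1 pow_eq_id prime_nat_iff)
  then show "G\<lparr>carrier := ?K\<rparr> \<cong> integer_mod_group p"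
    using generate_singleton_iso_integer_mod_group[OF x(1)] prime_p prime_gt_0_nat by metis
  show "frobenius_complement G ?K"
    unfolding frobenius_complement_def
  proof (intro conjI ballI)
    show "group G" by (rule is_group)
    show "finite (carrier G)" by (rule finite_carrier)
    show "subgroup ?K G" by (rule subK)
    show "?K \<noteq> {\<one>}" using xK \<open>x \<noteq> \<one>\<close> by blast
    show "?K \<noteq> carrier G"
    proof
      assume "?K = carrier G"
      then have "H \<subseteq> {\<one>}" using KH subset by auto
      then show False using nontriv one_closed by auto
    qed
    fix g assume "g \<in> carrier G - ?K"
    then have g: "g \<in> carrier G" "g \<notin> ?K" by auto
    \<comment> \<open>The factor of \<open>g\<close> in \<open>?K\<close> fixes \<open>y\<close> under conjugation, so only the factor \<open>h \<in> H\<close>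
      matters. Both \<open>y\<close> and its conjugate by \<open>h\<close> lie in \<open>?K\<close> and in one coset of \<open>H\<close>, hence
      coincide; so \<open>h\<close> commutes with \<open>y \<notin> H\<close>, and \<open>h = \<one>\<close>.\<close>
    have "y = \<one>" if y: "y \<in> ?K" "y \<in> inv g <# ?K #> g" for y
    proof (rule ccontr)
      assume "y \<noteq> \<one>"
      have yc: "y \<in> carrier G" using y(1) Kc by blast
      let ?z = "g \<otimes> y \<otimes> inv g"
      have z: "?z \<in> ?K" using y mem_conjugate_iff[OF Kc g(1) yc] by simp
      obtain i :: nat where "g \<in> H #> x [^] i" using mem_rcoset_pow[OF x g(1)] by blast
      then obtain h where h: "h \<in> H" and gh: "g = h \<otimes> x [^] i"
        unfolding r_coset_def by blast
      have hc: "h \<in> carrier G" using h subset by blast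
      have c: "x [^] i \<in> ?K" "x [^] i \<in> carrier G" using K x by auto
      have zh: "?z = h \<otimes> y \<otimes> inv h"
      proof -
        have "?z = h \<otimes> (x [^] i \<otimes> y) \<otimes> inv (x [^] i) \<otimes> inv h"
          unfolding gh using hc c yc by (simp add: inv_mult_group m_assoc)
        also have "\<dots> = h \<otimes> y \<otimes> inv h"
          unfolding K_comm[OF c(1) y(1)] using hc c yc by (simp add: m_assoc mult_inv_cancel_left)
        finally show ?thesis .
      qed
      have "?z \<otimes> inv y = h \<otimes> (y \<otimes> inv h \<otimes> inv y)"
        unfolding zh using hc yc by (simp add: m_assoc mult_inv_cancel_left)
      moreover have "y \<otimes> inv h \<otimes> inv y \<in> H" using inv_op_closed2[OF yc] h by simp
      ultimately have "?z \<otimes> inv y \<in> H" using h by simp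
      moreover have "?z \<otimes> inv y \<in> ?K"
        using subK z y(1) by (simp add: subgroup.m_closed subgroup.m_inv_closed)
      ultimately have "?z \<otimes> inv y = \<one>" using KH by blast
      then have "?z = y" using yc g(1) by (simp add: inv_solve_right')
      then have "y \<otimes> h = h \<otimes> y" unfolding zh using hc yc by (simp add: conjugate_inv_eq_iff)
      then have "h = \<one>" using cent[OF h _ yc] KH[OF y(1)] \<open>y \<noteq> \<one>\<close> by blast
      then show False using gh c g by simp
    qed
    moreover have "\<one> \<in> inv g <# ?K #> g"
      using mem_conjugate_iff[OF Kc g(1)] g oneK by simp
    ultimately show "?K \<inter> (inv g <# ?K #> g) = {\<one>}" using oneK by blast
  qed
  have H_avoids: "y = \<one>" if y: "y \<in> H" "g \<in> carrier G" "y \<in> inv g <# ?K #> g" for y g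
  proof -
    have yc: "y \<in> carrier G" using y subset by blast
    have "g \<otimes> y \<otimes> inv g = \<one>"
      using y mem_conjugate_iff[OF Kc y(2) yc] inv_op_closed2[OF y(2,1)] KH by blast
    then show ?thesis using y(2) yc by (simp add: conjugate_inv_eq_iff)
  qed
  have covered: "\<exists>g\<in>carrier G. y \<in> inv g <# ?K #> g" if y: "y \<in> carrier G" "y \<notin> H" for y
  proof -
    obtain i :: nat where i: "y \<in> H #> x [^] i" using mem_rcoset_pow[OF x y(1)] by blast
    have c: "x [^] i \<in> carrier G" "x [^] i \<in> ?K" using K x by auto
    have "x [^] i \<notin> H"
      using i y(2) mem_iff_rcoset_eq[OF c(1)] by blast
    then have "H #> x [^] i = conj_orbit G (x [^] i) H"
      using cent c by (intro rcoset_eq_conj_orbit[OF finite_H]) metis+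
    then obtain h where "h \<in> H" "y = inv h \<otimes> x [^] i \<otimes> h"
      using i by (auto simp: mem_conj_orbit_iff)
    then show ?thesis
      using c subset unfolding l_coset_def r_coset_def by blast
  qed
  show "frobenius_kernel G ?K = H"
  proof
    show "frobenius_kernel G ?K \<subseteq> H"
    proof
      fix y assume "y \<in> frobenius_kernel G ?K"
      then have "y = \<one> \<or> y \<in> carrier G \<and> (\<forall>g \<in> carrier G. y \<notin> inv g <# ?K #> g)"
        unfolding frobenius_kernel_def by simp
      then show "y \<in> H" using covered by auto
    qed
    show "H \<subseteq> frobenius_kernel G ?K"
    proof
      fix y assume "y \<in> H"
      then have "y \<in> carrier G" "\<And>g. g \<in> carrier G \<Longrightarrow> y \<in> inv g <# ?K #> g \<Longrightarrow> y = \<one>"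
        using subset H_avoids by auto
      then show "y \<in> frobenius_kernel G ?K"
        unfolding frobenius_kernel_def by auto
    qed
  qed
qed

lemma centralizers_subset_iff_frobenius:
  assumes nontriv: "H \<noteq> {\<one>}"
  shows "(\<forall>g \<in> H - {\<one>}. \<forall>x \<in> carrier G. x \<otimes> g = g \<otimes> x \<longrightarrow> x \<in> H)
    \<longleftrightarrow> (\<exists>K. frobenius_complement G K \<and> frobenius_kernel G K = H \<and>
          G\<lparr>carrier := K\<rparr> \<cong> integer_mod_group p)"
proof
  assume cent: "\<forall>g \<in> H - {\<one>}. \<forall>x \<in> carrier G. x \<otimes> g = g \<otimes> x \<longrightarrow> x \<in> H"
  obtain x where "x \<in> carrier G" "x \<notin> H" using proper subset by blast
  with cent show "\<exists>K. frobenius_complement G K \<and> frobenius_kernel G K = H \<and>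
            G\<lparr>carrier := K\<rparr> \<cong> integer_mod_group p"
    using frobenius_if_centralizers_subset[OF nontriv, of x] by blast
next
  assume "\<exists>K. frobenius_complement G K \<and> frobenius_kernel G K = H \<and>
            G\<lparr>carrier := K\<rparr> \<cong> integer_mod_group p"
  then show "\<forall>g \<in> H - {\<one>}. \<forall>x \<in> carrier G. x \<otimes> g = g \<otimes> x \<longrightarrow> x \<in> H"
    using centralizer_subset_frobenius_kernel by blast
qed

end

theorem proposition5:
  fixes G :: "('a, 'b) monoid_scheme" and H :: "'a set" and p :: nat
  assumes "group G" and "finite (carrier G)"
    and "H \<lhd> G"
    and "Factorial_Ring.prime p" and "card (rcosets\<^bsub>G\<^esub> H) = p"
    and "H \<noteq> {\<one>\<^bsub>G\<^esub>}"
  shows "(\<forall>g \<in> carrier G.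
            conj_class G g \<subseteq> H \<and> conj_class G g \<noteq> conj_class G \<one>\<^bsub>G\<^esub> \<longrightarrow> split_class G H g)
         \<longleftrightarrow>
         (\<exists>K. frobenius_complement G K \<and> frobenius_kernel G K = H \<and>
              G\<lparr>carrier := K\<rparr> \<cong> integer_mod_group p)"
proof -
  interpret normal_prime_index H G p
    using assms by (intro normal_prime_index.intro normal_prime_index_axioms.intro)
  show ?thesis
    using nontrivial_classes_split_iff centralizers_subset_iff_frobenius assms(6) by simp
qed

end
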